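(* Let $m,n$ be positive integers with $n\ge 2m-1$, and let $$S=\sum_{k=1}^\infty \frac{\left(\psi\left(\frac{2k+2n+5}{4}\right)-\psi\left(\frac{2k+2n+3}{4}\right)\right)\left(\frac12+(-1)^k\right)}{(2k+4m-2)^2}.$$ Then: (i) if $n=2m-1$: $$S=2-\sum_{k=1}^{2m-1}\sum_{j=0}^k\frac{(-1)^j\left(\frac12(-1)^k-1\right)}{k^2(2j+1)}+\left(-1+\sum_{k=1}^{2m-1}\frac{\frac12(-1)^k-1}{4k^2}\right)\pi+\frac{\pi^2}{6}-\frac{\pi^3}{96};$$ (ii) if $n=2m$: $$S=-\frac{70}{27}+\sum_{k=1}^{2m-1}\sum_{j=0}^{k+1}\frac{(-1)^j\left(\frac12(-1)^k-1\right)}{k^2(2j+1)}+\left(\frac{10}{9}-\sum_{k=1}^{2m-1}\frac{\frac12(-1)^k-1}{4k^2}\right)\pi-\frac{\pi^2}{9}+\frac{\pi^3}{96};$$ (iii) if $n-2m+1$ is odd and $n-2m+1\neq1$: $$\begin{aligned}S={}&-\frac{70}{27}+8\sum_{j=1}^{\frac{n-2m}{2}}\frac{(2j+1)(2H_{4j+1}-H_{2j})}{(4j+3)^2(4j+1)^2}+2\sum_{j=1}^{\frac{n-2m}{2}}\frac{1}{(4j+3)^3}+\sum_{k=1}^{2m-1}\sum_{j=0}^{k+n-2m+1}\frac{(-1)^{j+n}\left(\frac12(-1)^k-1\right)}{k^2(2j+1)}\\&-8\sum_{k=1}^{\frac{n-2m}{2}}\sum_{j=0}^{2k}\frac{(-1)^j(16k^2+16k+5)}{(2j+1)(4k+3)^2(4k+1)^2}\\&+\left(\frac{10}{9}+\sum_{j=1}^{\frac{n-2m}{2}}\frac{2(16j^2+16j+5)}{(4j+3)^2(4j+1)^2}-\sum_{k=1}^{2m-1}\frac{(-1)^n\left(\frac12(-1)^k-1\right)}{4k^2}\right)\pi\\&-\left(\frac19+\frac13\sum_{j=1}^{\frac{n-2m}{2}}\frac{1}{(4j+3)(4j+1)}\right)\pi^2+\frac{\pi^3}{96};\end{aligned}$$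 (iv) if $n-2m+1$ is even: $$\begin{aligned}S={}&2+16\sum_{j=0}^{\frac{n-2m-1}{2}}\frac{(j+1)(2H_{4j+3}-H_{2j+1})}{(4j+5)^2(4j+3)^2}+2\sum_{j=0}^{\frac{n-2m-1}{2}}\frac{1}{(4j+5)^3}+\sum_{k=1}^{2m-1}\sum_{j=0}^{k+n-2m+1}\frac{(-1)^{j+n}\left(\frac12(-1)^k-1\right)}{k^2(2j+1)}\\&+8\sum_{k=0}^{\frac{n-2m-1}{2}}\sum_{j=0}^{2k+1}\frac{(-1)^j(16k^2+32k+17)}{(2j+1)(4k+5)^2(4k+3)^2}\\&+\left(-1-\sum_{j=0}^{\frac{n-2m-1}{2}}\frac{2(16j^2+32j+17)}{(4j+5)^2(4j+3)^2}-\sum_{k=1}^{2m-1}\frac{(-1)^n\left(\frac12(-1)^k-1\right)}{4k^2}\right)\pi\\&+\left(\frac12-\sum_{j=0}^{\frac{n-2m-1}{2}}\frac{1}{(4j+5)(4j+3)}\right)\frac{\pi^2}{3}-\frac{\pi^3}{96}.\end{aligned}$$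
   Context: $\psi=\Gamma'/\Gamma$ is the digamma function and $H_n=\sum_{k=1}^n\frac1k$ is the $n$-th harmonic number. Empty sums (such as $\sum_{j=0}^{-1}$) are $0$. *)

theory Defs
  imports "HOL-Analysis.Analysis"
begin

definition S_term :: "nat \<Rightarrow> nat \<Rightarrow> nat \<Rightarrow> real" where
  "S_term m n k =
     (Digamma ((2 * real k + 2 * real n + 5) / 4) - Digamma ((2 * real k + 2 * real n + 3) / 4))
       * (1 / 2 + (-1) ^ k) / (2 * real k + 4 * real m - 2) ^ 2"

text \<open>The summation index of the series starts at 1, hence the shift by \<^const>\<open>Suc\<close>.\<close>

definition S :: "nat \<Rightarrow> nat \<Rightarrow> real" where
  "S m n = (\<Sum>k. S_term m n (Suc k))"

end

theory Submission
  imports Defs "HOL-Real_Asymp.Real_Asymp"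
begin

text \<open>
  Let \<open>C k\<close> be the partial sum of the first \<open>k\<close> terms of the Leibniz series for \<open>\<pi> / 4\<close>. The recurrence
  of the digamma function gives
  \<open>\<psi> ((2 N + 5) / 4) - \<psi> ((2 N + 3) / 4) = 4 (-1) ^ (N + 1) (\<pi> / 4 - C (N + 1))\<close>, so that, after putting
  \<open>K = k + 2 m - 1\<close> and \<open>q = n - 2 m + 2\<close>, the series becomes, up to finitely many terms, the sum
  over \<open>K \<ge> 1\<close> of \<open>(-1) ^ (q + 1) (1 - (-1) ^ K / 2) (\<pi> / 4 - C (K + q)) / K\<^sup>2\<close>.

  Passing from \<open>q\<close> to \<open>q + 1\<close> changes this sum by a series with terms
  \<open>((-1) ^ K - 1 / 2) / (K\<^sup>2 (2 K + 2 q + 1))\<close>, which partial fractions evaluate; the contributions of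
  \<open>ln 2\<close> cancel. There remains \<open>q = 0\<close>, that is, the sum of \<open>(1 - (-1) ^ K / 2) C K / K\<^sup>2\<close>. It is found by
  evaluating the integral of \<open>2 arctan x artanh x / x\<close> over the unit interval in two ways: expanding
  the integrand in powers of \<open>x\<close>, and expanding it in powers of \<open>u\<close> after substituting
  \<open>x = (1 - u) / (1 + u)\<close>.
\<close>

section \<open>Power series with coefficients \<open>c k / real k ^ s\<close>\<close>

text \<open>For \<open>s > 0\<close> the term with index \<open>0\<close> vanishes because of \<open>x / 0 = 0\<close>.\<close>

definition plog :: "(nat \<Rightarrow> real) \<Rightarrow> nat \<Rightarrow> real \<Rightarrow> real" where
  "plog c s y = (\<Sum>k. c k / real k ^ s * y ^ k)"

definition leibniz_sum :: "nat \<Rightarrow> real" where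
  "leibniz_sum k = (\<Sum>j<k. (-1) ^ j / (2 * real j + 1))"

lemma summable_plog:
  assumes c: "Bseq c" and y: "\<bar>y\<bar> < 1"
  shows "summable (\<lambda>k. c k / real k ^ s * y ^ k)"
proof -
  obtain B where c: "\<bar>c k\<bar> \<le> B" for k using \<open>Bseq c\<close> by (auto simp: Bseq_def)
  show ?thesis
  proof (rule summable_comparison_test')
    show "summable (\<lambda>k. B * \<bar>y\<bar> ^ k)"
      using y by (intro summable_mult summable_geometric) auto
    fix k :: nat assume "k \<ge> 1"
    then have "\<bar>c k\<bar> \<le> B * real k ^ s"
      using c[of k] by (smt (verit) mult_left_le one_le_power mult_le_cancel_left1 real_of_nat_ge_one_iff)
    then have "\<bar>c k\<bar> / real k ^ s \<le> B"
      using \<open>k \<ge> 1\<close> by (simp add: field_simps)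
    then show "norm (c k / real k ^ s * y ^ k) \<le> B * \<bar>y\<bar> ^ k"
      using mult_right_mono[of "\<bar>c k\<bar> / real k ^ s" B "\<bar>y\<bar> ^ k"] by (simp add: abs_mult power_abs)
  qed
qed

lemma plog_zero: "c 0 = 0 \<Longrightarrow> plog c s 0 = 0"
  unfolding plog_def by (subst powser_zero) simp

text \<open>Together the two parts say that \<open>y\<close> times the derivative lowers the
  exponent \<open>s\<close> by one; the shifted series keeps the derivative meaningful at
  \<open>y = 0\<close>. The hypothesis \<open>c 0 = 0\<close> removes the constant term when
  \<open>s = 0\<close>, where \<open>real 0 ^ 0 = 1\<close>.\<close>

lemma has_derivative_plog:
  assumes c: "Bseq c" and y: "\<bar>y\<bar> < 1" and "c 0 = 0"
  shows "(plog c (Suc s) has_real_derivative (\<Sum>k. c (Suc k) / real (Suc k) ^ s * y ^ k)) (at y)"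
    and "plog c s y = y * (\<Sum>k. c (Suc k) / real (Suc k) ^ s * y ^ k)"
proof -
  have d: "diffs (\<lambda>k. c k / real k ^ Suc s) = (\<lambda>k. c (Suc k) / real (Suc k) ^ s)"
    unfolding diffs_def by (auto simp: field_simps simp del: of_nat_Suc)
  show "(plog c (Suc s) has_real_derivative (\<Sum>k. c (Suc k) / real (Suc k) ^ s * y ^ k)) (at y)"
    using termdiffs_strong'[of 1 "\<lambda>k. c k / real k ^ Suc s" y, OF summable_plog[OF c]] y
    unfolding d plog_def[abs_def] by (simp del: power_Suc of_nat_Suc)
  show "plog c s y = y * (\<Sum>k. c (Suc k) / real (Suc k) ^ s * y ^ k)"
    using suminf_split_head[OF summable_plog[OF c y, of s]] \<open>c 0 = 0\<close>
      powser_split_head(1)[OF summable_plog[OF c y, of s]]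
    unfolding plog_def by (simp add: mult.commute)
qed

lemma DERIV_plog_compose:
  assumes c: "Bseq c" and c0: "c 0 = 0" and g: "(g has_real_derivative g') (at x)"
    and x: "\<bar>g x\<bar> < 1" "g x \<noteq> 0"
  shows "((\<lambda>x. plog c (Suc s) (g x)) has_real_derivative plog c s (g x) / g x * g') (at x)"
proof (rule DERIV_chain2[where f = "plog c (Suc s)", OF _ g])
  show "(plog c (Suc s) has_real_derivative plog c s (g x) / g x) (at (g x))"
    using has_derivative_plog[OF c x(1) c0, of s] x(2) by simp
qed

lemma continuous_on_plog:
  assumes c: "Bseq c" and "c 0 = 0"
  shows "continuous_on {-1<..<1} (plog c (Suc s))"
proof (intro continuous_at_imp_continuous_on ballI)
  fix y :: real assume "y \<in> {-1<..<1}"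
  then have "\<bar>y\<bar> < 1" by auto
  from has_derivative_plog(1)[OF c this \<open>c 0 = 0\<close>] show "isCont (plog c (Suc s)) y"
    by (rule DERIV_isCont)
qed

lemma summable_over_squares:
  assumes c: "Bseq c"
  shows "summable (\<lambda>k. c k / real k ^ 2 :: real)"
proof -
  obtain B where c: "\<bar>c k\<bar> \<le> B" for k using \<open>Bseq c\<close> by (auto simp: Bseq_def)
  show ?thesis
  proof (rule summable_comparison_test')
    show "summable (\<lambda>k. B * (1 / real k ^ 2))"
      using inverse_power_summable[of 2] by (intro summable_mult) (simp add: inverse_eq_divide)
    show "norm (c k / real k ^ 2) \<le> B * (1 / real k ^ 2)" for k
      using c[of k] by (simp add: divide_right_mono)
  qed
qed

text \<open>For exponent 2 convergence is uniform on the closed interval, so the values at 1, which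
  are the sums of interest, are limits from inside.\<close>

lemma continuous_on_plog_2:
  assumes c: "Bseq c"
  shows "continuous_on {-1..1} (plog c 2)"
proof -
  have "uniform_limit {-1..1} (\<lambda>n y. \<Sum>k<n. c k / real k ^ 2 * y ^ k)
         (\<lambda>y. \<Sum>k. c k / real k ^ 2 * y ^ k) sequentially"
  proof (rule Weierstrass_m_test)
    show "summable (\<lambda>k. \<bar>c k\<bar> / real k ^ 2)"
      using c by (intro summable_over_squares) (auto simp: Bseq_def)
    fix k :: nat and y :: real assume "y \<in> {-1..1}"
    then have "\<bar>y\<bar> ^ k \<le> 1" by (intro power_le_one) auto
    then show "norm (c k / real k ^ 2 * y ^ k) \<le> \<bar>c k\<bar> / real k ^ 2"
      using mult_left_le[of "\<bar>y\<bar> ^ k" "\<bar>c k\<bar> / real k ^ 2"] by (simp add: abs_mult power_abs)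
  qed
  then show ?thesis unfolding plog_def[abs_def]
    by (rule uniform_limit_theorem[rotated])
      (rule sequentially_bot, intro always_eventually allI continuous_on_sum
        continuous_on_mult_left continuous_on_power continuous_on_id)
qed

section \<open>Leibniz partial sums and their generating functions\<close>

lemma leibniz_sum_0 [simp]: "leibniz_sum 0 = 0"
  by (simp add: leibniz_sum_def)

lemma leibniz_sum_Suc: "leibniz_sum (Suc k) = leibniz_sum k + (-1) ^ k / (2 * real k + 1)"
  by (simp add: leibniz_sum_def)

text \<open>The induction carries a stronger invariant: the sum after one more term must stay in the
  unit interval too. The decreasing size of the terms preserves it.\<close>

lemma abs_leibniz_sum_le: "\<bar>leibniz_sum k\<bar> \<le> 1"
proof -
  have "(even k \<longrightarrow> 0 \<le> leibniz_sum k \<and> leibniz_sum k + 1 / (2 * real k + 1) \<le> 1) \<and>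
        (odd k \<longrightarrow> leibniz_sum k \<le> 1 \<and> 0 \<le> leibniz_sum k - 1 / (2 * real k + 1))"
  proof (induction k)
    case (Suc k)
    have "1 / (2 * real (Suc k) + 1) \<le> 1 / (2 * real k + 1)"
      by (intro divide_left_mono) auto
    then show ?case using Suc by (auto simp: leibniz_sum_Suc)
  qed auto
  moreover have "1 / (2 * real k + 1) \<ge> 0" by simp
  ultimately show ?thesis unfolding abs_le_iff by (cases "even k") linarith+
qed

lemma Bseq_leibniz_sum: "Bseq leibniz_sum"
  using abs_leibniz_sum_le by (intro BseqI'[of _ 1]) simp

lemma leibniz_sum_tendsto: "leibniz_sum \<longlonglongrightarrow> pi / 4"
proof -
  have "summable (\<lambda>k. (-1) ^ k * 1 / real (k * 2 + 1))"
    using summable_arctan_series[of 1] by simp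
  from summable_sums[OF this] show ?thesis
    unfolding pi_series[symmetric] sums_def leibniz_sum_def[abs_def]
    by (simp add: mult.commute add.commute)
qed

text \<open>Multiplying the generating function of the partial sums \<open>c\<close> by
  \<open>1 - y\<close> leaves that of the increments \<open>d\<close>; the factor \<open>y\<close>
  is there because \<open>d k\<close> first enters in \<open>c (Suc k)\<close>.\<close>

lemma plog_partial_sums:
  assumes c: "Bseq c" and y: "\<bar>y\<bar> < 1" and c0: "c 0 = 0"
    and d: "\<And>k. c (Suc k) = c k + d k" and "(\<lambda>k. d k * y ^ k) sums t"
  shows "(1 - y) * plog c 0 y = y * t"
proof -
  have s: "(\<lambda>k. c k * y ^ k) sums plog c 0 y"
    using summable_sums[OF summable_plog[OF c y, of 0]] by (simp add: plog_def)
  have "(\<lambda>k. c (Suc k) * y ^ Suc k) sums plog c 0 y"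
    using s c0 by (subst sums_Suc_iff) simp
  then have "(\<lambda>k. y * (c (Suc k) * y ^ k)) sums plog c 0 y" by (simp add: mult_ac)
  moreover have "(\<lambda>k. y * (c k * y ^ k)) sums (y * plog c 0 y)" using s by (rule sums_mult)
  ultimately have "(\<lambda>k. y * (c (Suc k) * y ^ k) - y * (c k * y ^ k)) sums (plog c 0 y - y * plog c 0 y)"
    by (rule sums_diff)
  then have "(\<lambda>k. y * (d k * y ^ k)) sums (plog c 0 y - y * plog c 0 y)"
    by (simp add: d algebra_simps)
  moreover have "(\<lambda>k. y * (d k * y ^ k)) sums (y * t)" using assms(5) by (rule sums_mult)
  ultimately show ?thesis by (simp add: sums_iff algebra_simps)
qed

text \<open>This is the quadratic logarithm series at \<open>(1 + x) / (1 - x)\<close>, the argument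
  for which its ratio becomes \<open>x\<close>.\<close>

lemma artanh_sums:
  assumes "\<bar>x\<bar> < 1"
  shows "(\<lambda>k. x ^ (2 * k + 1) / (2 * real k + 1)) sums artanh x"
proof -
  have "(1 + x) / (1 - x) > 0" using assms by (auto simp: abs_less_iff)
  from ln_series_quadratic[OF this]
  have "(\<lambda>n. 2 * (((1 + x) / (1 - x) - 1) / ((1 + x) / (1 - x) + 1)) ^ (2 * n + 1)
            / real (2 * n + 1)) sums (2 * artanh x)"
    by (simp only: artanh_def) simp
  also have "((1 + x) / (1 - x) - 1) / ((1 + x) / (1 - x) + 1) = x"
    using assms by (simp add: divide_simps)
  finally have "(\<lambda>n. 2 * (x ^ (2 * n + 1) / (2 * real n + 1))) sums (2 * artanh x)"
    by (simp add: add.commute)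
  from sums_mult[OF this, of "1/2"] show ?thesis by simp
qed

lemma arctan_sums:
  assumes "\<bar>x\<bar> < 1"
  shows "(\<lambda>k. (-1) ^ k * x ^ (2 * k + 1) / (2 * real k + 1)) sums arctan x"
  using summable_sums[OF summable_arctan_series[of x]] arctan_series[of x] assms
  by (simp add: mult.commute add.commute)

lemma plog_leibniz_arctan:
  assumes "\<bar>x\<bar> < 1"
  shows "plog leibniz_sum 0 (x ^ 2) = x * arctan x / (1 - x ^ 2)"
proof (cases "x = 0")
  case False
  have y: "\<bar>x ^ 2\<bar> < 1" using assms by (simp add: abs_square_less_1)
  have "(\<lambda>k. (-1) ^ k / (2 * real k + 1) * (x ^ 2) ^ k) sums (arctan x / x)"
    using sums_divide[OF arctan_sums[OF assms], of x] False by (simp add: power_mult)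
  from plog_partial_sums[OF Bseq_leibniz_sum y _ leibniz_sum_Suc this]
  show ?thesis using y False by (simp add: field_simps power2_eq_square)
qed (simp add: plog_zero)

text \<open>At \<open>- (x ^ 2)\<close> the alternating signs of the increments cancel, so
  \<open>artanh x / x\<close> takes the place of \<open>arctan x / x\<close>.\<close>

lemma plog_leibniz_artanh:
  assumes "\<bar>x\<bar> < 1"
  shows "plog leibniz_sum 0 (- (x ^ 2)) = - x * artanh x / (1 + x ^ 2)"
proof (cases "x = 0")
  case False
  have y: "\<bar>- (x ^ 2)\<bar> < 1" using assms by (simp add: abs_square_less_1)
  have "(-1) ^ k * (- (x ^ 2)) ^ k = (x ^ 2) ^ k" for k
    by (simp flip: power_mult_distrib)
  then have "(\<lambda>k. (-1) ^ k / (2 * real k + 1) * (- (x ^ 2)) ^ k) sums (artanh x / x)"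
    using sums_divide[OF artanh_sums[OF assms], of x] False
    by (simp add: power_mult \<open>\<And>k. (-1) ^ k * (- (x ^ 2)) ^ k = (x ^ 2) ^ k\<close>)
  from plog_partial_sums[OF Bseq_leibniz_sum y _ leibniz_sum_Suc this]
  have "(1 + x ^ 2) * plog leibniz_sum 0 (- (x ^ 2)) = - x * artanh x"
    using False by (simp add: power2_eq_square)
  moreover have "1 + x ^ 2 \<noteq> 0" by (smt (verit) zero_le_power2)
  ultimately show ?thesis by (simp add: field_simps)
qed (simp add: plog_zero)

section \<open>Reciprocal squares and series over odd indices\<close>

lemma alternating_squares_sums: "(\<lambda>k. (-1) ^ k / real k ^ 2) sums (- (pi ^ 2 / 12))"
  and squares_sums: "(\<lambda>k. 1 / real k ^ 2) sums (pi ^ 2 / 6)"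
proof -
  have "(\<lambda>k. 1 / real (Suc k) ^ 2) sums (pi ^ 2 / 6)"
    using inverse_squares_sums by (simp add: add.commute)
  then show sq: "(\<lambda>k. 1 / real k ^ 2) sums (pi ^ 2 / 6)"
    by (subst (asm) sums_Suc_iff) simp
  \<comment> \<open>The alternating series is twice the even-indexed part minus the full series; by
    reindexing, twice the even part is half of \<open>pi ^ 2 / 6\<close>.\<close>
  have "(\<lambda>k. if even k then 2 / real k ^ 2 else 0) sums (pi ^ 2 / 12)"
  proof (subst sums_mono_reindex[of "\<lambda>k. 2 * k", symmetric])
    show "(\<lambda>n. if even (2 * n) then 2 / real (2 * n) ^ 2 else 0) sums (pi ^ 2 / 12)"
      using sums_mult[OF sq, of "1/2"] by (simp add: power_mult_distrib)
  qed (auto simp: strict_mono_def elim!: evenE)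
  from sums_diff[OF this sq]
  have "(\<lambda>k. (if even k then 2 / real k ^ 2 else 0) - 1 / real k ^ 2) sums (- (pi ^ 2 / 12))"
    by simp
  moreover have "(if even k then 2 / real k ^ 2 else 0) - 1 / real k ^ 2 = (-1) ^ k / real k ^ 2" for k
    by (simp add: diff_divide_distrib[symmetric])
  ultimately show "(\<lambda>k. (-1) ^ k / real k ^ 2) sums (- (pi ^ 2 / 12))" by simp
qed

definition odd_ind :: "nat \<Rightarrow> real" where
  "odd_ind k = (1 - (-1) ^ k) / 2"

lemma odd_ind_0 [simp]: "odd_ind 0 = 0" by (simp add: odd_ind_def)

lemma Bseq_odd_ind: "Bseq odd_ind"
proof (rule BseqI'[of _ 1])
  show "norm (odd_ind k) \<le> 1" for k by (cases "even k") (auto simp: odd_ind_def)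
qed

lemma plog_odd_ind_artanh:
  assumes "\<bar>x\<bar> < 1"
  shows "plog odd_ind 1 x = artanh x"
proof -
  have "(\<lambda>n. (- ((- x) ^ n) / real n - (- ((- (- x)) ^ n) / real n)) / 2) sums ((ln (1 + x) - ln (1 + - x)) / 2)"
    using assms by (intro sums_divide sums_diff ln_series') auto
  moreover have "(- ((- x) ^ n) / real n - (- ((- (- x)) ^ n) / real n)) / 2 = odd_ind n / real n ^ 1 * x ^ n" for n
    by (cases "even n") (auto simp: odd_ind_def)
  ultimately show ?thesis
    using assms by (simp add: plog_def sums_iff artanh_def ln_div abs_less_iff)
qed

lemma plog_odd_ind_2_1: "plog odd_ind 2 1 = pi ^ 2 / 8"
proof -
  have "(\<lambda>k. (1 / real k ^ 2 - (-1) ^ k / real k ^ 2) / 2) sums ((pi ^ 2 / 6 - - (pi ^ 2 / 12)) / 2)"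
    by (intro sums_divide sums_diff squares_sums alternating_squares_sums)
  moreover have "(1 / real k ^ 2 - (-1) ^ k / real k ^ 2) / 2 = odd_ind k / real k ^ 2" for k
    by (simp add: odd_ind_def diff_divide_distrib)
  ultimately show ?thesis by (simp add: plog_def sums_iff)
qed

text \<open>Near the endpoint 1 an exponent-1 series is controlled only up to logarithmic growth;
  this suffices, since it will occur with a factor \<open>ln u\<close>.\<close>

lemma plog_1_bound:
  assumes c: "\<And>k. \<bar>c k\<bar> \<le> 1" and y: "\<bar>y\<bar> < 1"
  shows "\<bar>plog c 1 y\<bar> \<le> - ln (1 - \<bar>y\<bar>)"
proof -
  have B: "Bseq c" using c by (intro BseqI'[of _ 1]) simp
  have s: "(\<lambda>n. \<bar>y\<bar> ^ n / real n) sums (- ln (1 - \<bar>y\<bar>))"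
    using sums_minus[OF ln_series'[of "- \<bar>y\<bar>"]] y by simp
  have le: "norm (c k / real k ^ 1 * y ^ k) \<le> \<bar>y\<bar> ^ k / real k" for k
    using mult_right_mono[OF c[of k], of "\<bar>y\<bar> ^ k / real k"] by (simp add: abs_mult power_abs)
  have "norm (plog c 1 y) \<le> (\<Sum>k. \<bar>y\<bar> ^ k / real k)"
    unfolding plog_def by (intro norm_suminf_le le sums_summable[OF s])
  then show ?thesis using s by (simp add: sums_iff)
qed

section \<open>Power series of the product of arctan and artanh\<close>

definition odd_leibniz :: "nat \<Rightarrow> real" where
  "odd_leibniz k = (1 - (-1) ^ k) * leibniz_sum k"

lemma odd_leibniz_0 [simp]: "odd_leibniz 0 = 0" by (simp add: odd_leibniz_def)

lemma Bseq_odd_leibniz: "Bseq odd_leibniz"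
proof (rule BseqI'[of _ 2])
  show "norm (odd_leibniz k) \<le> 2" for k
    using abs_leibniz_sum_le[of k] by (cases "even k") (auto simp: odd_leibniz_def)
qed

text \<open>The factor \<open>1 - (-1) ^ k\<close> amounts to taking the difference of the Leibniz
  generating functions at \<open>x ^ 2\<close> and \<open>- (x ^ 2)\<close>.\<close>

lemma plog_odd_leibniz_0:
  assumes "\<bar>x\<bar> < 1"
  shows "plog odd_leibniz 0 (x ^ 2) = x * arctan x / (1 - x ^ 2) + x * artanh x / (1 + x ^ 2)"
proof -
  have y: "\<bar>x ^ 2\<bar> < 1" "\<bar>- (x ^ 2)\<bar> < 1" using assms by (simp_all add: abs_square_less_1)
  have "plog odd_leibniz 0 (x ^ 2) = plog leibniz_sum 0 (x ^ 2) - plog leibniz_sum 0 (- (x ^ 2))"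
    unfolding plog_def
    using suminf_diff[OF summable_plog[OF Bseq_leibniz_sum y(1), of 0]
        summable_plog[OF Bseq_leibniz_sum y(2), of 0]]
    by (simp add: odd_leibniz_def power_minus[of "x ^ 2"] algebra_simps)
  then show ?thesis using assms by (simp add: plog_leibniz_arctan plog_leibniz_artanh)
qed

text \<open>Both sides vanish at 0, and the two summands of \<open>plog_odd_leibniz_0\<close>, times
  \<open>2 / x\<close>, are those of the product rule on the right.\<close>

lemma plog_odd_leibniz_1:
  assumes x: "0 < x" "x < 1"
  shows "plog odd_leibniz 1 (x ^ 2) = 2 * arctan x * artanh x"
proof -
  let ?f = "\<lambda>x. plog odd_leibniz 1 (x ^ 2) - 2 * arctan x * artanh x"
  have "?f x = ?f 0"
  proof (rule DERIV_isconst_end[of 0 x ?f])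
    have "z ^ 2 \<in> {-1<..<1}" if "z \<in> {0..x}" for z
      using that x order.strict_trans2[of "-1" "0::real" "z ^ 2"] by (auto simp: abs_square_less_1)
    then have "continuous_on {0..x} (\<lambda>z. plog odd_leibniz 1 (z ^ 2))"
      unfolding One_nat_def
      by (intro continuous_on_compose2[OF continuous_on_plog[OF Bseq_odd_leibniz, of 0]]
          continuous_intros) auto
    then show "continuous_on {0..x} ?f"
      using x by (intro continuous_intros) auto
    show "(?f has_real_derivative 0) (at z)" if "0 < z" "z < x" for z
    proof -
      have z: "\<bar>z\<bar> < 1" "\<bar>z ^ 2\<bar> < 1" "z \<noteq> 0" "z ^ 2 \<noteq> 1"
        using that x by (auto simp: abs_square_less_1 abs_square_eq_1 power2_eq_1_iff)
      have d: "((\<lambda>z. plog odd_leibniz 1 (z ^ 2)) has_real_derivative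
                 plog odd_leibniz 0 (z ^ 2) / z ^ 2 * (2 * z)) (at z)"
        unfolding One_nat_def
        by (rule DERIV_plog_compose) (use z Bseq_odd_leibniz in \<open>auto intro!: derivative_eq_intros\<close>)
      have "(?f has_real_derivative plog odd_leibniz 0 (z ^ 2) / z ^ 2 * (2 * z)
              - (2 * inverse (1 + z ^ 2) * artanh z + 1 / (1 - z ^ 2) * (2 * arctan z))) (at z)"
        by (intro DERIV_diff d DERIV_mult DERIV_cmult DERIV_arctan artanh_real_has_field_derivative z)
      moreover have "1 + z ^ 2 \<noteq> 0" by (smt (verit) zero_le_power2)
      then have "plog odd_leibniz 0 (z ^ 2) / z ^ 2 * (2 * z)
              - (2 * inverse (1 + z ^ 2) * artanh z + 1 / (1 - z ^ 2) * (2 * arctan z)) = 0"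
        unfolding plog_odd_leibniz_0[OF z(1)] using z
        by (simp add: divide_simps) (simp add: algebra_simps power2_eq_square)
      ultimately show ?thesis by simp
    qed
  qed (use x in auto)
  then show ?thesis by (simp add: plog_zero)
qed

section \<open>The reflection of the unit interval and the resulting constant\<close>

text \<open>
  With \<open>x = (1 - u) / (1 + u)\<close> one has \<open>arctan x = \<pi> / 4 - arctan u\<close> and \<open>artanh x = - ln u / 2\<close>; the last
  three summands come from integrating \<open>arctan x * artanh x / x\<close> by parts in the variable \<open>u\<close>.
\<close>

definition reflection_fun :: "real \<Rightarrow> real" where
  "reflection_fun u = plog odd_leibniz 2 (((1 - u) / (1 + u)) ^ 2) / 2 - plog leibniz_sum 2 (u ^ 2) / 2
     + ln u * plog leibniz_sum 1 (u ^ 2) - pi / 2 * (ln u * artanh u - plog odd_ind 2 u)"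

text \<open>The first summand has derivative
  \<open>2 * (pi / 4 - arctan u) * ln u / (1 - u ^ 2)\<close>. Its \<open>arctan u\<close> part is
  cancelled by the two \<open>leibniz_sum\<close> summands through
  \<open>plog_leibniz_arctan\<close>, its \<open>pi / 4\<close> part by the last summand.\<close>

lemma DERIV_reflection_fun:
  assumes u: "0 < u" "u < 1"
  shows "(reflection_fun has_real_derivative 0) (at u)"
proof -
  define x where "x = (1 - u) / (1 + u)"
  have x: "0 < x" "x < 1" using u by (auto simp: x_def field_simps)
  have x2: "\<bar>x ^ 2\<bar> < 1" "x ^ 2 \<noteq> 0" and u2: "\<bar>u ^ 2\<bar> < 1" "u ^ 2 \<noteq> 0" and u1: "\<bar>u\<bar> < 1" "u \<noteq> 0"
    using x u by (auto simp: abs_square_less_1)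
  have at: "arctan x = pi / 4 - arctan u"
  proof -
    \<comment> \<open>Here \<open>u + x\<close> equals \<open>1 - u * x\<close>, so the addition
      formula yields \<open>arctan 1\<close>.\<close>
    have "arctan u + arctan x = arctan ((u + x) / (1 - u * x))"
      using u x by (intro arctan_add) auto
    also have "1 - u * x = (1 + u ^ 2) / (1 + u)" and "u + x = (1 + u ^ 2) / (1 + u)"
      using u by (simp_all add: x_def field_simps power2_eq_square)
    moreover have "1 + u ^ 2 > 0" by (smt (verit) zero_le_power2)
    ultimately have "arctan u + arctan x = arctan 1" using u by simp
    then show ?thesis by (simp add: arctan_one)
  qed
  have ath: "artanh x = - ln u / 2"
  proof -
    have "1 + x = 2 / (1 + u)" "1 - x = 2 * u / (1 + u)" using u by (simp_all add: x_def field_simps)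
    moreover have "(2 / c) / (2 * u / c) = 1 / u" if "c \<noteq> 0" for c using that u by simp
    ultimately have "(1 + x) / (1 - x) = 1 / u" using u by (metis add_pos_pos less_irrefl zero_less_one)
    then show ?thesis using u by (simp add: artanh_def ln_div)
  qed
  have dx: "((\<lambda>u. (1 - u) / (1 + u)) has_real_derivative (- 2 / (1 + u) ^ 2)) (at u)"
    using u by (auto intro!: derivative_eq_intros simp: field_simps power2_eq_square)
  have d1: "((\<lambda>u. plog odd_leibniz 2 (((1 - u) / (1 + u)) ^ 2)) has_real_derivative
               plog odd_leibniz 1 (x ^ 2) / x ^ 2 * (2 * x * (- 2 / (1 + u) ^ 2))) (at u)"
    using DERIV_plog_compose[OF Bseq_odd_leibniz odd_leibniz_0 DERIV_power[OF dx, of 2], of 1] x2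
    unfolding Suc_1 by (simp add: x_def mult_ac)
  have "((\<lambda>u. u ^ 2) has_real_derivative 2 * u) (at u)"
    by (auto intro!: derivative_eq_intros)
  note du = DERIV_plog_compose[OF Bseq_leibniz_sum leibniz_sum_0 this u2]
  have d2: "((\<lambda>u. plog leibniz_sum 2 (u ^ 2)) has_real_derivative
               plog leibniz_sum 1 (u ^ 2) / u ^ 2 * (2 * u)) (at u)"
    using du[of 1] unfolding Suc_1 .
  have d3: "((\<lambda>u. plog leibniz_sum 1 (u ^ 2)) has_real_derivative
               plog leibniz_sum 0 (u ^ 2) / u ^ 2 * (2 * u)) (at u)"
    using du[of 0] unfolding One_nat_def .
  have d4: "(plog odd_ind 2 has_real_derivative artanh u / u) (at u)"
    using DERIV_plog_compose[OF Bseq_odd_ind odd_ind_0 DERIV_ident u1, of 1]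
    unfolding Suc_1 plog_odd_ind_artanh[OF u1(1)] by simp
  have "(reflection_fun has_real_derivative
      plog odd_leibniz 1 (x ^ 2) / x ^ 2 * (2 * x * (- 2 / (1 + u) ^ 2)) / 2
      - plog leibniz_sum 1 (u ^ 2) / u ^ 2 * (2 * u) / 2
      + (1 / u * plog leibniz_sum 1 (u ^ 2) + plog leibniz_sum 0 (u ^ 2) / u ^ 2 * (2 * u) * ln u)
      - pi / 2 * (1 / u * artanh u + 1 / (1 - u ^ 2) * ln u - artanh u / u)) (at u)"
    unfolding reflection_fun_def[abs_def]
    by (intro DERIV_diff DERIV_add DERIV_cdivide DERIV_mult DERIV_cmult d1 d2 d3 d4
          artanh_real_has_field_derivative u1 DERIV_ln_divide u)
  also have "plog odd_leibniz 1 (x ^ 2) / x ^ 2 * (2 * x * (- 2 / (1 + u) ^ 2)) / 2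
       = 2 * (pi / 4 - arctan u) * ln u / (1 - u ^ 2)"
  proof -
    have "plog odd_leibniz 1 (x ^ 2) / x ^ 2 * (2 * x * (- 2 / (1 + u) ^ 2)) / 2
        = 2 * (pi / 4 - arctan u) * ln u / (x * (1 + u) ^ 2)"
      unfolding plog_odd_leibniz_1[OF x] at ath using x
      by (simp add: power2_eq_square)
    also have "x * (1 + u) ^ 2 = 1 - u ^ 2"
      using u by (simp add: x_def field_simps power2_eq_square)
    finally show ?thesis .
  qed
  also have "plog leibniz_sum 0 (u ^ 2) / u ^ 2 * (2 * u) * ln u = 2 * arctan u * ln u / (1 - u ^ 2)"
    unfolding plog_leibniz_arctan[OF u1(1)] using u by (simp add: power2_eq_square)
  also have "2 * (pi / 4 - arctan u) * ln u / (1 - u ^ 2)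
      - plog leibniz_sum 1 (u ^ 2) / u ^ 2 * (2 * u) / 2
      + (1 / u * plog leibniz_sum 1 (u ^ 2) + 2 * arctan u * ln u / (1 - u ^ 2))
      - pi / 2 * (1 / u * artanh u + 1 / (1 - u ^ 2) * ln u - artanh u / u) = 0"
    using u u2 by (simp add: divide_simps) (simp add: algebra_simps power2_eq_square)
  finally show ?thesis .
qed

text \<open>\<open>reflection_fun\<close> is constant, so its limits at both ends agree. At 0 only
  \<open>plog odd_leibniz 2 1 / 2\<close> survives; at 1 there remain
  \<open>- plog leibniz_sum 2 1 / 2\<close> and \<open>pi / 2 * plog odd_ind 2 1\<close>.\<close>

lemma plog_2_1_identity: "plog odd_leibniz 2 1 + plog leibniz_sum 2 1 = pi ^ 3 / 8"
proof -
  have const: "reflection_fun u = reflection_fun (1 / 2)" if "u \<in> {0<..<1}" for u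
    by (rule DERIV_isconst3[of 0 1])
       (use that DERIV_reflection_fun in auto)
  have pl2: "((\<lambda>u. plog c 2 (g u)) \<longlongrightarrow> plog c 2 l) F"
    if "Bseq c" "(g \<longlongrightarrow> l) F" "\<forall>\<^sub>F u in F. g u \<in> {-1..1}" "l \<in> {-1..1}" for c g l F
    by (rule continuous_on_tendsto_compose[OF continuous_on_plog_2[OF that(1)] that(2,4,3)])
  \<comment> \<open>Handles both ends at once: the logarithmic bound reduces the claim to
    \<open>ln u * ln (1 - u ^ 2)\<close>.\<close>
  have pl1: "((\<lambda>u. ln u * plog leibniz_sum 1 (u ^ 2)) \<longlongrightarrow> 0) F"
    if "\<forall>\<^sub>F u in F. u \<in> {0<..<1}" "((\<lambda>u. ln u * ln (1 - u ^ 2)) \<longlongrightarrow> 0) F" for F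
  proof (rule Lim_null_comparison[OF _ that(2)], use that(1) in eventually_elim)
    case (elim u)
    have "\<bar>u ^ 2\<bar> < 1" using elim by (auto simp: abs_square_less_1)
    from plog_1_bound[OF abs_leibniz_sum_le this]
    have "\<bar>ln u\<bar> * \<bar>plog leibniz_sum 1 (u ^ 2)\<bar> \<le> \<bar>ln u\<bar> * - ln (1 - u ^ 2)"
      by (intro mult_left_mono) auto
    then show ?case using elim by (simp add: abs_mult)
  qed
  have e0: "\<forall>\<^sub>F u in at_right 0. u \<in> {0<..<1::real}"
    by (rule eventually_at_right_real) simp
  have e1: "\<forall>\<^sub>F u in at_left 1. u \<in> {0<..<1::real}"
    by (rule eventually_at_left_real) simp
  have ex: "((1 - u) / (1 + u)) ^ 2 \<in> {-1..1}" if "u \<in> {0<..<1}" for u :: real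
  proof -
    have "0 \<le> (1 - u) / (1 + u)" "(1 - u) / (1 + u) \<le> 1" using that by auto
    then have "((1 - u) / (1 + u)) ^ 2 \<le> 1" by (rule power_le_one)
    moreover have "0 \<le> ((1 - u) / (1 + u)) ^ 2" by (rule zero_le_power2)
    ultimately show ?thesis unfolding atLeastAtMost_iff by linarith
  qed
  have eu: "u ^ 2 \<in> {-1..1}" "u \<in> {-1..1}" if "u \<in> {0<..<1}" for u :: real
    using that order_trans[of "-1" "0::real" "u ^ 2"] by (auto simp: abs_square_le_1)
  have "(reflection_fun \<longlongrightarrow>
        plog odd_leibniz 2 1 / 2 - plog leibniz_sum 2 0 / 2 + 0 - pi / 2 * (0 - plog odd_ind 2 0)) (at_right 0)"
    unfolding reflection_fun_def[abs_def]
  proof (intro tendsto_intros pl2 pl1 Bseq_odd_leibniz Bseq_leibniz_sum Bseq_odd_ind e0)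
    show "((\<lambda>u::real. ln u * ln (1 - u\<^sup>2)) \<longlongrightarrow> 0) (at_right 0)" by real_asymp
    show "((\<lambda>u::real. ln u * artanh u) \<longlongrightarrow> 0) (at_right 0)" unfolding artanh_def by real_asymp
    show "((\<lambda>u::real. ((1 - u) / (1 + u))\<^sup>2) \<longlongrightarrow> 1) (at_right 0)" by real_asymp
    show "((\<lambda>u::real. u\<^sup>2) \<longlongrightarrow> 0) (at_right 0)" by real_asymp
  qed (use e0 ex eu in \<open>auto elim!: eventually_mono\<close>)
  moreover have "(reflection_fun \<longlongrightarrow>
        plog odd_leibniz 2 0 / 2 - plog leibniz_sum 2 1 / 2 + 0 - pi / 2 * (0 - plog odd_ind 2 1)) (at_left 1)"
    unfolding reflection_fun_def[abs_def]
  proof (intro tendsto_intros pl2 pl1 Bseq_odd_leibniz Bseq_leibniz_sum Bseq_odd_ind e1)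
    show "((\<lambda>u::real. ln u * ln (1 - u\<^sup>2)) \<longlongrightarrow> 0) (at_left 1)" by real_asymp
    show "((\<lambda>u::real. ln u * artanh u) \<longlongrightarrow> 0) (at_left 1)" unfolding artanh_def by real_asymp
    show "((\<lambda>u::real. ((1 - u) / (1 + u))\<^sup>2) \<longlongrightarrow> 0) (at_left 1)" by real_asymp
    show "((\<lambda>u::real. u\<^sup>2) \<longlongrightarrow> 1) (at_left 1)" by real_asymp
  qed (use e1 ex eu in \<open>auto elim!: eventually_mono\<close>)
  moreover have "(reflection_fun \<longlongrightarrow> reflection_fun (1 / 2)) (at_right 0)"
      "(reflection_fun \<longlongrightarrow> reflection_fun (1 / 2)) (at_left 1)"
    by (intro tendsto_eventually eventually_mono[OF e0] eventually_mono[OF e1] const; assumption)+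
  ultimately have "plog odd_leibniz 2 1 / 2 - plog leibniz_sum 2 0 / 2 + 0 - pi / 2 * (0 - plog odd_ind 2 0)
      = plog odd_leibniz 2 0 / 2 - plog leibniz_sum 2 1 / 2 + 0 - pi / 2 * (0 - plog odd_ind 2 1)"
    using tendsto_unique[OF trivial_limit_at_right_real] tendsto_unique[OF trivial_limit_at_left_real]
    by (metis (no_types))
  then show ?thesis
    by (simp add: plog_zero plog_odd_ind_2_1 power2_eq_square power3_eq_cube)
qed

text \<open>The weight \<open>1 - (-1) ^ k / 2\<close> is the mean of \<open>1 - (-1) ^ k\<close>
  and 1, hence half of \<open>plog_2_1_identity\<close>.\<close>

lemma leibniz_sum_squares_sums:
  "(\<lambda>k. (1 - (-1) ^ k / 2) * leibniz_sum k / real k ^ 2) sums (pi ^ 3 / 16)"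
proof -
  have "(\<lambda>k. (odd_leibniz k / real k ^ 2 + leibniz_sum k / real k ^ 2) / 2) sums
          ((plog odd_leibniz 2 1 + plog leibniz_sum 2 1) / 2)"
    unfolding plog_def using summable_over_squares[OF Bseq_odd_leibniz] summable_over_squares[OF Bseq_leibniz_sum]
    by (intro sums_divide sums_add) (simp_all add: summable_sums)
  moreover have "(odd_leibniz k / real k ^ 2 + leibniz_sum k / real k ^ 2) / 2
      = (1 - (-1) ^ k / 2) * leibniz_sum k / real k ^ 2" for k
    by (cases "k = 0") (simp_all add: odd_leibniz_def field_simps)
  ultimately show ?thesis unfolding plog_2_1_identity by simp
qed

section \<open>Leibniz series and digamma differences\<close>

lemma leibniz_sums: "(\<lambda>k. (-1) ^ k / (2 * real k + 1)) sums (pi / 4)"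
  using leibniz_sum_tendsto by (simp add: sums_def leibniz_sum_def[abs_def])

text \<open>Raising \<open>N\<close> by one turns the smaller argument into the old larger one, and
  the larger argument into the old smaller one plus 1. So the difference changes sign and gains
  \<open>4 / (2 N + 3)\<close>, just as the right-hand side does.\<close>

lemma Digamma_quarter_diff:
  "Digamma ((2 * real N + 5) / 4) - Digamma ((2 * real N + 3) / 4)
     = 4 * (-1) ^ Suc N * (pi / 4 - leibniz_sum (Suc N))"
proof (induction N)
  case 0
  have "(\<lambda>n. inverse (real (Suc n)) - inverse (z + real n)) sums (Digamma z + euler_mascheroni)"
    if "z \<noteq> 0" for z :: real
    using summable_sums[OF summable_Digamma[OF that]] by (simp add: Digamma_def)
  from sums_diff[OF this[of "5 / 4"] this[of "3 / 4"]]
  have "(\<lambda>n. inverse (3 / 4 + real n) - inverse (5 / 4 + real n)) sums (Digamma (5 / 4) - Digamma (3 / 4 :: real))"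
    by simp
  \<comment> \<open>Each summand is \<open>4 / (4 n + 3) - 4 / (4 n + 5)\<close>, a pair of
    consecutive Leibniz terms.\<close>
  moreover have "(\<Sum>n<M. inverse (3 / 4 + real n) - inverse (5 / 4 + real n)) = 4 - 4 * leibniz_sum (2 * M + 1)" for M
  proof (induction M)
    case (Suc M)
    have "leibniz_sum (2 * Suc M + 1) = leibniz_sum (2 * M + 1) - 1 / (4 * real M + 3) + 1 / (4 * real M + 5)"
      by (simp add: leibniz_sum_Suc algebra_simps)
    then show ?case using Suc by (simp add: divide_simps) (simp add: algebra_simps)
  qed (simp add: leibniz_sum_Suc)
  moreover have "(\<lambda>M. leibniz_sum (2 * M + 1)) \<longlonglongrightarrow> pi / 4"
    using LIMSEQ_subseq_LIMSEQ[OF leibniz_sum_tendsto, of "\<lambda>M. 2 * M + 1"]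
    by (simp add: strict_mono_def o_def)
  then have "(\<lambda>M. 4 - 4 * leibniz_sum (2 * M + 1)) \<longlonglongrightarrow> 4 - 4 * (pi / 4)"
    by (intro tendsto_intros)
  ultimately have "Digamma (5 / 4) - Digamma (3 / 4 :: real) = 4 - 4 * (pi / 4)"
    unfolding sums_def by (simp add: LIMSEQ_unique)
  then show ?case by (simp add: leibniz_sum_Suc)
next
  case (Suc N)
  have step: "Digamma ((2 * real N + 3) / 4 + 1) = Digamma ((2 * real N + 3) / 4) + 1 / ((2 * real N + 3) / 4)"
    by (rule Digamma_plus1) auto
  have shift: "(2 * real (Suc N) + 5) / 4 = (2 * real N + 3) / 4 + 1" by (simp add: field_simps)
  have "Digamma ((2 * real (Suc N) + 5) / 4) = Digamma ((2 * real N + 3) / 4) + 4 / (2 * real N + 3)"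
    unfolding shift step by simp
  moreover have "Digamma ((2 * real (Suc N) + 3) / 4) = Digamma ((2 * real N + 5) / 4)"
    by (simp add: add.commute)
  ultimately have "Digamma ((2 * real (Suc N) + 5) / 4) - Digamma ((2 * real (Suc N) + 3) / 4)
      = 4 / (2 * real N + 3) - 4 * (-1) ^ Suc N * (pi / 4 - leibniz_sum (Suc N))"
    using Suc by linarith
  also have "\<dots> = 4 * (-1) ^ Suc (Suc N) * (pi / 4 - leibniz_sum (Suc (Suc N)))"
    by (cases "even N") (simp_all add: leibniz_sum_Suc[of "Suc N"] algebra_simps)
  finally show ?case .
qed

section \<open>Odd harmonic sums and the partial fraction series\<close>

definition odd_harm :: "nat \<Rightarrow> real" where
  "odd_harm k = (\<Sum>j<k. 1 / (2 * real j + 1))"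

lemma odd_harm_Suc: "odd_harm (Suc k) = odd_harm k + 1 / (2 * real k + 1)"
  by (simp add: odd_harm_def)

text \<open>The even terms of \<open>harm (2 * k)\<close> add up to half of \<open>harm k\<close>.
  This is the source of the differences of harmonic numbers in the theorem.\<close>

lemma odd_harm_eq: "2 * odd_harm k = 2 * harm (2 * k) - harm k"
proof (induction k)
  case (Suc k)
  have "harm (2 * Suc k) = harm (2 * k) + 1 / (2 * real k + 1) + 1 / (2 * (real k + 1))"
    by (simp add: harm_Suc inverse_eq_divide add_ac)
  moreover have "harm (Suc k) = harm k + 2 * (1 / (2 * (real k + 1)))"
    by (simp add: harm_Suc field_simps)
  ultimately show ?case using Suc unfolding odd_harm_Suc by (simp only: distrib_left)
qed (simp add: odd_harm_def harm_def)

lemma odd_reciprocal_telescope: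
  "(\<lambda>k. 2 / (2 * real k + 2 * real q + 1) - 2 / (2 * real k + 2 * real q + 3)) sums (2 / (2 * real q + 1))"
proof -
  have "(\<lambda>k. 2 / (2 * real k + 2 * real q + 1)) \<longlonglongrightarrow> 0" by real_asymp
  from telescope_sums'[OF this] show ?thesis by (simp add: algebra_simps)
qed

text \<open>For \<open>q = 0\<close> this is the alternating harmonic series up to a telescoping
  correction; raising \<open>q\<close> by one adds another telescoping series.\<close>

lemma harmonic_diff_sums:
  "(\<lambda>k. 1 / real (Suc k) - 2 / (2 * real (Suc k) + 2 * real q + 1)) sums (2 * odd_harm (Suc q) - 2 * ln 2)"
proof (induction q)
  case 0
  have "(\<lambda>k. (2 / (2 * real k + 2 * real 0 + 1) - 2 / (2 * real k + 2 * real 0 + 3))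
          - 2 * (inverse (real (2 * k + 1)) - inverse (real (2 * k + 2)))) sums (2 / (2 * real 0 + 1) - 2 * ln 2)"
    by (intro sums_diff sums_mult odd_reciprocal_telescope alternating_harmonic_series_sums')
  moreover have "(2 / (2 * real k + 2 * real 0 + 1) - 2 / (2 * real k + 2 * real 0 + 3))
          - 2 * (inverse (real (2 * k + 1)) - inverse (real (2 * k + 2)))
        = 1 / real (Suc k) - 2 / (2 * real (Suc k) + 2 * real 0 + 1)" for k
    by (simp add: divide_simps) (simp add: algebra_simps)
  ultimately show ?case by (simp add: odd_harm_def)
next
  case (Suc q)
  from sums_add[OF Suc odd_reciprocal_telescope[of "Suc q"]] show ?case
    by (simp add: odd_harm_Suc[of "Suc q"] algebra_simps)
qed

definition alt_quotient_sum :: "nat \<Rightarrow> real" where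
  "alt_quotient_sum q = - (pi ^ 2) / (6 * (2 * real q + 1))
     + (4 * (-1) ^ q * (pi / 4 - leibniz_sum (Suc q)) + 2 * odd_harm (Suc q)) / (2 * real q + 1) ^ 2"

text \<open>With \<open>c = 2 q + 1\<close>, partial fractions give \<open>1 / (x^2 (2 x + c)) = 1 /
  (c x^2) - 2 / c^2 * (1 / x - 2 / (2 x + c))\<close>. The \<open>ln 2\<close> of the alternating
  part \<open>?a\<close> cancels against that of \<open>harmonic_diff_sums\<close>.\<close>

lemma alt_quotient_sums:
  "(\<lambda>k. ((-1) ^ k - 1 / 2) / (real k ^ 2 * (2 * real k + 2 * real q + 1))) sums alt_quotient_sum q"
proof -
  define c where "c = 2 * real q + 1"
  have "c > 0" by (simp add: c_def)
  let ?h = "\<lambda>k. 1 / real (Suc k) - 2 / (2 * real (Suc k) + 2 * real q + 1)"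
  let ?a = "\<lambda>k. (-1) ^ Suc k / real (Suc k)"
  \<comment> \<open>A Leibniz tail from index \<open>Suc q\<close> on: its denominators are those in
    \<open>?h\<close>, and the prefactor \<open>(-1) ^ q\<close> makes its signs
    \<open>(-1) ^ Suc k\<close>.\<close>
  let ?l = "\<lambda>k. 2 * (-1) ^ q * ((-1) ^ (k + Suc q) / (2 * real (k + Suc q) + 1))"
  have a: "?a sums (- ln 2)"
    using sums_minus[OF alternating_harmonic_series_sums] by simp
  have l: "?l sums (2 * (-1) ^ q * (pi / 4 - leibniz_sum (Suc q)))"
    unfolding leibniz_sum_def by (intro sums_mult sums_split_initial_segment leibniz_sums)
  have "(\<lambda>k. ?a k - ?l k - 1 / 2 * ?h k) sums
      (- ln 2 - 2 * (-1) ^ q * (pi / 4 - leibniz_sum (Suc q)) - 1 / 2 * (2 * odd_harm (Suc q) - 2 * ln 2))"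
    by (intro sums_diff a l sums_mult harmonic_diff_sums)
  moreover have "?a k - ?l k - 1 / 2 * ?h k = ((-1) ^ Suc k - 1 / 2) * ?h k" for k
  proof -
    have gen: "f / x - 2 * (f / y) - 1 / 2 * (1 / x - 2 / y) = (f - 1 / 2) * (1 / x - 2 / y)" for f x y :: real
      by (simp add: algebra_simps diff_divide_distrib)
    have "(-1) ^ q * (-1) ^ (k + Suc q) = ((-1) ^ Suc k :: real)"
      by (cases "even k"; cases "even q") simp_all
    then have "2 * (-1) ^ q * ((-1) ^ (k + Suc q) / y) = 2 * ((-1) ^ Suc k / y)" for y :: real
      by (metis (no_types, lifting) mult.assoc times_divide_eq_right)
    moreover have "2 * real (k + Suc q) + 1 = 2 * real (Suc k) + 2 * real q + 1" by simp
    ultimately have "?l k = 2 * ((-1) ^ Suc k / (2 * real (Suc k) + 2 * real q + 1))" by presburger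
    then show ?thesis
      by (simp only: gen)
  qed
  moreover have "- ln 2 - 2 * (-1) ^ q * (pi / 4 - leibniz_sum (Suc q)) - 1 / 2 * (2 * odd_harm (Suc q) - 2 * ln 2)
      = - 2 * (-1) ^ q * (pi / 4 - leibniz_sum (Suc q)) - odd_harm (Suc q)" by (simp add: field_simps)
  ultimately have e: "(\<lambda>k. ((-1) ^ Suc k - 1 / 2) * ?h k) sums
      (- 2 * (-1) ^ q * (pi / 4 - leibniz_sum (Suc q)) - odd_harm (Suc q))"
    by (simp only:)
  have "(\<lambda>k. (-1) ^ k / real k ^ 2 - 1 / 2 * (1 / real k ^ 2)) sums (- (pi ^ 2 / 12) - 1 / 2 * (pi ^ 2 / 6))"
    by (intro sums_diff sums_mult squares_sums alternating_squares_sums)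
  then have s: "(\<lambda>k. (-1) ^ Suc k / real (Suc k) ^ 2 - 1 / 2 * (1 / real (Suc k) ^ 2)) sums (- (pi ^ 2 / 6))"
    by (subst sums_Suc_iff) simp
  have "(\<lambda>k. ((-1) ^ Suc k / real (Suc k) ^ 2 - 1 / 2 * (1 / real (Suc k) ^ 2)) / c
          - 2 / c ^ 2 * (((-1) ^ Suc k - 1 / 2) * ?h k)) sums
      (- (pi ^ 2 / 6) / c - 2 / c ^ 2 * (- 2 * (-1) ^ q * (pi / 4 - leibniz_sum (Suc q)) - odd_harm (Suc q)))"
    by (intro sums_diff sums_divide sums_mult s e)
  moreover have "((-1) ^ Suc k / real (Suc k) ^ 2 - 1 / 2 * (1 / real (Suc k) ^ 2)) / c
          - 2 / c ^ 2 * (((-1) ^ Suc k - 1 / 2) * ?h k)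
      = ((-1) ^ Suc k - 1 / 2) / (real (Suc k) ^ 2 * (2 * real (Suc k) + 2 * real q + 1))" for k
  proof -
    have "(f / x ^ 2 - 1 / 2 * (1 / x ^ 2)) / c - 2 / c ^ 2 * ((f - 1 / 2) * (1 / x - 2 / (2 * x + c)))
      = (f - 1 / 2) / (x ^ 2 * (2 * x + c))" if "x > 0" for f x :: real
    proof -
      have "2 * x + c > 0" using that \<open>c > 0\<close> by simp
      then have "1 / (x ^ 2 * (2 * x + c)) = 1 / x ^ 2 / c - 2 / c ^ 2 * (1 / x - 2 / (2 * x + c))"
        using that \<open>c > 0\<close> by (simp add: divide_simps) (simp add: algebra_simps power2_eq_square)
      then have "(f - 1 / 2) * (1 / (x ^ 2 * (2 * x + c)))
          = (f - 1 / 2) * (1 / x ^ 2 / c - 2 / c ^ 2 * (1 / x - 2 / (2 * x + c)))" by simp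
      then show ?thesis by (simp add: algebra_simps diff_divide_distrib)
    qed
    from this[of "real (Suc k)" "(-1) ^ Suc k"] show ?thesis by (simp add: c_def add.assoc)
  qed
  ultimately have "(\<lambda>k. ((-1) ^ Suc k - 1 / 2) / (real (Suc k) ^ 2 * (2 * real (Suc k) + 2 * real q + 1))) sums
      (- (pi ^ 2 / 6) / c - 2 / c ^ 2 * (- 2 * (-1) ^ q * (pi / 4 - leibniz_sum (Suc q)) - odd_harm (Suc q)))"
    by simp
  moreover have "- (pi ^ 2 / 6) / c - 2 / c ^ 2 * (- 2 * (-1) ^ q * (pi / 4 - leibniz_sum (Suc q)) - odd_harm (Suc q))
      = alt_quotient_sum q"
    unfolding alt_quotient_sum_def c_def[symmetric] using \<open>c > 0\<close> by (simp add: field_simps)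
  ultimately show ?thesis by (subst (asm) sums_Suc_iff) simp
qed

section \<open>Recurrence in the shift \<open>q\<close>\<close>

fun tail_val :: "nat \<Rightarrow> real" where
  "tail_val 0 = pi ^ 3 / 96"
| "tail_val (Suc q) = - tail_val q - alt_quotient_sum q"

text \<open>From \<open>q\<close> to \<open>q + 1\<close> the sign flips and
  \<open>leibniz_sum\<close> gains \<open>(-1) ^ (k + q) / (2 k + 2 q + 1)\<close>. With
  \<open>s = (-1) ^ k\<close>, the identity \<open>(1 - s / 2) * s = s - 1 / 2\<close> turns the
  gain into the term of \<open>alt_quotient_sums\<close>.\<close>

lemma tail_sums:
  "(\<lambda>k. (-1) ^ Suc q * (1 - (-1) ^ k / 2) * (pi / 4 - leibniz_sum (k + q)) / real k ^ 2) sums tail_val q"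
proof (induction q)
  case 0
  have "(\<lambda>k. (1 - (-1) ^ k / 2) * leibniz_sum k / real k ^ 2
          - pi / 4 * (1 / real k ^ 2 - 1 / 2 * ((-1) ^ k / real k ^ 2)))
        sums (pi ^ 3 / 16 - pi / 4 * (pi ^ 2 / 6 - 1 / 2 * (- (pi ^ 2 / 12))))"
    by (intro sums_diff sums_mult leibniz_sum_squares_sums squares_sums alternating_squares_sums)
  moreover have "pi ^ 3 / 16 - pi / 4 * (pi ^ 2 / 6 - 1 / 2 * (- (pi ^ 2 / 12))) = tail_val 0"
    by (simp add: power2_eq_square power3_eq_cube)
  moreover have "(1 - (-1) ^ k / 2) * leibniz_sum k / real k ^ 2
          - pi / 4 * (1 / real k ^ 2 - 1 / 2 * ((-1) ^ k / real k ^ 2))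
      = (-1) ^ Suc 0 * (1 - (-1) ^ k / 2) * (pi / 4 - leibniz_sum (k + 0)) / real k ^ 2" for k
    by (cases "k = 0") (simp_all add: field_simps)
  ultimately show ?case by simp
next
  case (Suc q)
  have eq: "- ((-1) ^ Suc q * (1 - (-1) ^ k / 2) * (pi / 4 - leibniz_sum (k + q)) / real k ^ 2)
      - ((-1) ^ k - 1 / 2) / (real k ^ 2 * (2 * real k + 2 * real q + 1))
    = (-1) ^ Suc (Suc q) * (1 - (-1) ^ k / 2) * (pi / 4 - leibniz_sum (k + Suc q)) / real k ^ 2" for k
  proof (cases "k = 0")
    case False
    define c where "c = 2 * real k + 2 * real q + 1"
    have "c > 0" by (simp add: c_def)
    \<comment> \<open>Replacing the sign powers by variables with values 1 and -1 leaves four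
      rational identities.\<close>
    have "- (- t * (1 - s / 2) * (P - C) / d) - (s - 1 / 2) / (d * c) = t * (1 - s / 2) * (P - (C + s * t / c)) / d"
      if "s = 1 \<or> s = -1" "t = 1 \<or> t = -1" "d > 0" for s t d P C :: real
      using that \<open>c > 0\<close> by (elim disjE) (simp_all add: divide_simps, simp_all add: algebra_simps)
    note this[of "(-1) ^ k" "(-1) ^ q" "real k ^ 2" "pi / 4" "leibniz_sum (k + q)"]
    moreover have "leibniz_sum (k + Suc q) = leibniz_sum (k + q) + (-1) ^ k * (-1) ^ q / c"
      by (simp add: leibniz_sum_Suc power_add c_def)
    moreover have "(-1) ^ k = (1::real) \<or> (-1) ^ k = (-1::real)" for k by (cases "even k") auto
    ultimately show ?thesis using False unfolding c_def[symmetric] by simp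
  qed simp
  from sums_diff[OF sums_minus[OF Suc] alt_quotient_sums[of q]] show ?case
    unfolding eq by simp
qed

text \<open>Two steps restore the sign of \<open>tail_val q\<close>, so each parity class of indices
  accumulates an ordinary sum. The cubic term is the net effect, \<open>4 - 2\<close>, of the last
  increments of \<open>leibniz_sum\<close> and \<open>odd_harm\<close>.\<close>

lemma tail_val_Suc_Suc:
  "tail_val (Suc (Suc q)) = tail_val q + (- (pi ^ 2) / 3) / ((2 * real q + 3) * (2 * real q + 1))
     + 4 * (-1) ^ q * (pi / 4 - leibniz_sum (Suc q)) * (2 * (4 * real q ^ 2 + 8 * real q + 5))
         / ((2 * real q + 3) ^ 2 * (2 * real q + 1) ^ 2)
     + 16 * (real q + 1) * odd_harm (Suc q) / ((2 * real q + 3) ^ 2 * (2 * real q + 1) ^ 2)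
     + 2 / (2 * real q + 3) ^ 3"
proof -
  define c d where "c = 2 * real q + 1" and "d = 2 * real q + 3"
  have c: "c > 0" "d > 0" by (simp_all add: c_def d_def)
  define t where "t = ((-1) ^ q :: real)"
  have t: "t = 1 \<or> t = -1" by (cases "even q") (auto simp: t_def)
  have "tail_val (Suc (Suc q)) = tail_val q + alt_quotient_sum q - alt_quotient_sum (Suc q)" by simp
  also have "alt_quotient_sum q = - (pi ^ 2) / (6 * c) + (4 * t * (pi / 4 - leibniz_sum (Suc q)) + 2 * odd_harm (Suc q)) / c ^ 2"
    by (simp add: alt_quotient_sum_def c_def t_def)
  also have "alt_quotient_sum (Suc q) = - (pi ^ 2) / (6 * d)
      + (- 4 * t * (pi / 4 - leibniz_sum (Suc q) + t / d) + 2 * (odd_harm (Suc q) + 1 / d)) / d ^ 2"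
    by (simp add: alt_quotient_sum_def t_def d_def leibniz_sum_Suc[of "Suc q"] odd_harm_Suc[of "Suc q"] add_ac)
  also have "tail_val q + (- (pi ^ 2) / (6 * c) + (4 * t * (pi / 4 - leibniz_sum (Suc q)) + 2 * odd_harm (Suc q)) / c ^ 2)
     - (- (pi ^ 2) / (6 * d) + (- 4 * t * (pi / 4 - leibniz_sum (Suc q) + t / d) + 2 * (odd_harm (Suc q) + 1 / d)) / d ^ 2)
    = tail_val q - pi ^ 2 / 6 * (1 / c - 1 / d)
      + 4 * t * (pi / 4 - leibniz_sum (Suc q)) * (1 / c ^ 2 + 1 / d ^ 2)
      + 2 * odd_harm (Suc q) * (1 / c ^ 2 - 1 / d ^ 2) + 2 / d ^ 3"
  proof -
    have "t * (t / d) / d ^ 2 = 1 / d ^ 3" using t c by (auto simp: power2_eq_square power3_eq_cube)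
    moreover have "1 / d / d ^ 2 = 1 / d ^ 3" by (simp add: power2_eq_square power3_eq_cube)
    ultimately show ?thesis by (simp add: algebra_simps add_divide_distrib diff_divide_distrib)
  qed
  also have "1 / c - 1 / d = 2 / (d * c)" using c by (simp add: c_def d_def divide_simps)
  also have "1 / c ^ 2 + 1 / d ^ 2 = (c ^ 2 + d ^ 2) / (d ^ 2 * c ^ 2)" using c by (simp add: divide_simps)
  also have "c ^ 2 + d ^ 2 = 2 * (4 * real q ^ 2 + 8 * real q + 5)"
    by (simp add: c_def d_def power2_eq_square algebra_simps)
  also have "1 / c ^ 2 - 1 / d ^ 2 = (d ^ 2 - c ^ 2) / (d ^ 2 * c ^ 2)" using c by (simp add: divide_simps)
  also have "d ^ 2 - c ^ 2 = 8 * (real q + 1)"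
    by (simp add: c_def d_def power2_eq_square algebra_simps)
  finally show ?thesis by (simp add: c_def d_def t_def)
qed

section \<open>Closed forms for odd and even indices\<close>

lemma half_diff_cancel:
  fixes x h g a b :: real
  assumes "2 * x = 2 * (h + a) - (g + b)" "2 * a = b"
  shows "x = (2 * h - g) / 2"
  using assms by simp

lemma leibniz_sum_atMost: "(\<Sum>j = 0..k. (-1) ^ j * a / ((2 * real j + 1) * b * c)) = a / (b * c) * leibniz_sum (Suc k)"
proof -
  have "(\<Sum>j = 0..k. (-1) ^ j * a / ((2 * real j + 1) * b * c)) = (\<Sum>j<Suc k. a / (b * c) * ((-1) ^ j / (2 * real j + 1)))"
    by (intro sum.cong) (auto simp: field_simps)
  then show ?thesis by (simp only: leibniz_sum_def sum_distrib_left)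
qed

lemma tail_val_odd:
  "tail_val (2 * N + 1) = 2
        + 16 * (\<Sum>j<N. (real j + 1) * (2 * harm (4 * j + 3) - harm (2 * j + 1))
               / ((4 * real j + 5) ^ 2 * (4 * real j + 3) ^ 2))
        + 2 * (\<Sum>j<N. 1 / (4 * real j + 5) ^ 3)
        + 8 * (\<Sum>k<N. \<Sum>j = 0..2 * k + 1.
             (-1) ^ j * (16 * real k ^ 2 + 32 * real k + 17)
               / ((2 * real j + 1) * (4 * real k + 5) ^ 2 * (4 * real k + 3) ^ 2))
        + (- 1 - (\<Sum>j<N. 2 * (16 * real j ^ 2 + 32 * real j + 17)
                   / ((4 * real j + 5) ^ 2 * (4 * real j + 3) ^ 2))) * pi
        + (1 / 2 - (\<Sum>j<N. 1 / ((4 * real j + 5) * (4 * real j + 3)))) * (pi ^ 2 / 3)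
        - pi ^ 3 / 96"
proof (induction N)
  case 0
  show ?case by (simp add: alt_quotient_sum_def leibniz_sum_Suc odd_harm_def algebra_simps)
next
  case (Suc N)
  have "harm (4 * N + 4) = harm (4 * N + 3) + 1 / (4 * real N + 4)"
    and "harm (2 * N + 2) = harm (2 * N + 1) + 1 / (2 * real N + 2)"
    using harm_Suc[of "4 * N + 3", where 'a = real] harm_Suc[of "2 * N + 1", where 'a = real]
    by (simp_all add: inverse_eq_divide add_ac)
  moreover have "2 * (1 / (4 * real N + 4)) = 1 / (2 * real N + 2)" by (simp add: field_simps)
  moreover have "2 * (2 * N + 2) = 4 * N + 4" by simp
  \<comment> \<open>The last summands of \<open>harm (4 * N + 4)\<close> and
    \<open>harm (2 * N + 2)\<close> cancel, which leaves the smaller indices of the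
    statement.\<close>
  ultimately have oh: "odd_harm (2 * N + 2) = (2 * harm (4 * N + 3) - harm (2 * N + 1)) / 2"
    using odd_harm_eq[of "2 * N + 2"] by (metis half_diff_cancel)
  define A B C where "A = 4 * real N + 5" and "B = 4 * real N + 3" and "C = leibniz_sum (2 * N + 2)"
  define P where "P = 16 * real N ^ 2 + 32 * real N + 17"
  have q: "2 * real (2 * N + 1) + 3 = A" "2 * real (2 * N + 1) + 1 = B" "real (2 * N + 1) + 1 = 2 * (real N + 1)"
    "4 * real (2 * N + 1) ^ 2 + 8 * real (2 * N + 1) + 5 = P"
    by (simp_all add: A_def B_def P_def power2_eq_square algebra_simps)
  have s: "2 * Suc N + 1 = Suc (Suc (2 * N + 1))" "Suc (2 * N + 1) = 2 * N + 2" "(-1) ^ (2 * N + 1) = (-1 :: real)" by simp_all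
  have "tail_val (2 * Suc N + 1) = tail_val (2 * N + 1) + (- (pi ^ 2) / 3) / (A * B)
     + 4 * (-1) * (pi / 4 - C) * (2 * P) / (A ^ 2 * B ^ 2)
     + 16 * (2 * (real N + 1)) * ((2 * harm (4 * N + 3) - harm (2 * N + 1)) / 2) / (A ^ 2 * B ^ 2) + 2 / A ^ 3"
    unfolding s(1) unfolding tail_val_Suc_Suc unfolding q s(2,3) oh C_def ..
  also have "\<dots> = tail_val (2 * N + 1) + 16 * ((real N + 1) * (2 * harm (4 * N + 3) - harm (2 * N + 1)) / (A ^ 2 * B ^ 2))
      + 2 * (1 / A ^ 3) + 8 * (P / (A ^ 2 * B ^ 2) * C) - 2 * P / (A ^ 2 * B ^ 2) * pi - 1 / (A * B) * (pi ^ 2 / 3)"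
    by (simp add: algebra_simps add_divide_distrib diff_divide_distrib)
  finally show ?case
    unfolding Suc.IH sum.lessThan_Suc leibniz_sum_atMost s(2) A_def[symmetric] B_def[symmetric] C_def[symmetric]
      P_def[symmetric] by (simp add: algebra_simps add_divide_distrib diff_divide_distrib)
qed

lemma tail_val_even:
  "tail_val (2 * N + 2) = - (70 / 27)
        + 8 * (\<Sum>j = 1..N. (2 * real j + 1) * (2 * harm (4 * j + 1) - harm (2 * j))
               / ((4 * real j + 3) ^ 2 * (4 * real j + 1) ^ 2))
        + 2 * (\<Sum>j = 1..N. 1 / (4 * real j + 3) ^ 3)
        - 8 * (\<Sum>k = 1..N. \<Sum>j = 0..2 * k.
             (-1) ^ j * (16 * real k ^ 2 + 16 * real k + 5)
               / ((2 * real j + 1) * (4 * real k + 3) ^ 2 * (4 * real k + 1) ^ 2))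
        + (10 / 9 + (\<Sum>j = 1..N. 2 * (16 * real j ^ 2 + 16 * real j + 5)
                   / ((4 * real j + 3) ^ 2 * (4 * real j + 1) ^ 2))) * pi
        - (1 / 9 + 1 / 3 * (\<Sum>j = 1..N. 1 / ((4 * real j + 3) * (4 * real j + 1)))) * pi ^ 2
        + pi ^ 3 / 96"
proof (induction N)
  case 0
  show ?case by (simp add: alt_quotient_sum_def leibniz_sum_Suc odd_harm_def numeral_2_eq_2)
     (simp add: field_simps power2_eq_square)
next
  case (Suc M)
  \<comment> \<open>The sums start at 1, so the summand added in this step has index
    \<open>Suc M\<close>; the two-step recurrence is used at
    \<open>2 * N = 2 * M + 2\<close>.\<close>
  define N where "N = Suc M"
  have split: "sum g {1..Suc M} = sum g {1..M} + g N" for g :: "nat \<Rightarrow> real"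
    by (simp add: N_def)
  have "harm (4 * N + 2) = harm (4 * N + 1) + 1 / (4 * real N + 2)"
    and "harm (2 * N + 1) = harm (2 * N) + 1 / (2 * real N + 1)"
    using harm_Suc[of "4 * N + 1", where 'a = real] harm_Suc[of "2 * N", where 'a = real]
    by (simp_all add: inverse_eq_divide add_ac)
  moreover have "2 * (1 / (4 * real N + 2)) = 1 / (2 * real N + 1)" by (simp add: field_simps)
  ultimately have oh: "odd_harm (2 * N + 1) = (2 * harm (4 * N + 1) - harm (2 * N)) / 2"
    using odd_harm_eq[of "2 * N + 1"] by simp
  define A B C where "A = 4 * real N + 3" and "B = 4 * real N + 1" and "C = leibniz_sum (2 * N + 1)"
  define P where "P = 16 * real N ^ 2 + 16 * real N + 5"
  have q: "2 * real (2 * N) + 3 = A" "2 * real (2 * N) + 1 = B" "real (2 * N) + 1 = 2 * real N + 1"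
    "4 * real (2 * N) ^ 2 + 8 * real (2 * N) + 5 = P"
    by (simp_all add: A_def B_def P_def power2_eq_square algebra_simps)
  have s: "2 * Suc M + 2 = Suc (Suc (2 * N))" "Suc (2 * N) = 2 * N + 1" "(-1) ^ (2 * N) = (1 :: real)"
    "2 * M + 2 = 2 * N" by (simp_all add: N_def)
  have "tail_val (2 * Suc M + 2) = tail_val (2 * M + 2) + (- (pi ^ 2) / 3) / (A * B)
     + 4 * 1 * (pi / 4 - C) * (2 * P) / (A ^ 2 * B ^ 2)
     + 16 * (2 * real N + 1) * ((2 * harm (4 * N + 1) - harm (2 * N)) / 2) / (A ^ 2 * B ^ 2) + 2 / A ^ 3"
    unfolding s(1,4) unfolding tail_val_Suc_Suc unfolding q s(2,3) oh C_def ..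
  also have "\<dots> = tail_val (2 * M + 2) + 8 * ((2 * real N + 1) * (2 * harm (4 * N + 1) - harm (2 * N)) / (A ^ 2 * B ^ 2))
      + 2 * (1 / A ^ 3) - 8 * (P / (A ^ 2 * B ^ 2) * C) + 2 * P / (A ^ 2 * B ^ 2) * pi - 1 / 3 * (1 / (A * B)) * pi ^ 2"
    by (simp add: algebra_simps add_divide_distrib diff_divide_distrib)
  finally show ?case
    unfolding Suc.IH split leibniz_sum_atMost s(2) A_def[symmetric] B_def[symmetric] C_def[symmetric]
      P_def[symmetric] by (simp add: algebra_simps)
qed

section \<open>Reduction of the digamma series and assembly\<close>

lemma S_sums:
  assumes "m \<ge> 1" and np: "n + 1 = 2 * m + p"
  shows "(\<lambda>k. S_term m n (Suc k)) sums (tail_val (Suc p)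
     - (\<Sum>k = 1..2 * m - 1. (-1) ^ p * (1 - (-1) ^ k / 2) * (pi / 4 - leibniz_sum (k + Suc p)) / real k ^ 2))"
proof -
  let ?f = "\<lambda>k. (-1) ^ p * (1 - (-1) ^ k / 2) * (pi / 4 - leibniz_sum (k + Suc p)) / real k ^ 2"
  have "?f sums tail_val (Suc p)" using tail_sums[of "Suc p"] by simp
  from sums_split_initial_segment[OF this, of "2 * m"]
  have "(\<lambda>k. ?f (k + 2 * m)) sums (tail_val (Suc p) - sum ?f {..<2 * m})" .
  \<comment> \<open>The term with index 0 is 0 by division by zero, so the removed segment may start
    at 1.\<close>
  moreover have "sum ?f {..<2 * m} = sum ?f {1..2 * m - 1}"
    using assms(1) by (intro sum.mono_neutral_right) auto
  moreover have "?f (k + 2 * m) = S_term m n (Suc k)" for k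
  proof -
    define K where "K = k + 2 * m"
    have K: "Suc k + n = K + p" using np by (simp add: K_def)
    have kn: "2 * real (Suc k) + 2 * real n = 2 * real (K + p)"
      unfolding K[symmetric] by simp
    have "2 * real (Suc k) + 4 * real m - 2 = 2 * real K" by (simp add: K_def)
    \<comment> \<open>Hence the weight is \<open>1 / 2 - (-1) ^ K\<close>; times the digamma sign
      \<open>(-1) ^ Suc (K + p)\<close> it becomes
      \<open>(-1) ^ p * (1 - (-1) ^ K / 2)\<close>.\<close>
    moreover have "(-1) ^ Suc k = (- ((-1) ^ K) :: real)" by (simp add: K_def power_add)
    moreover define T where "T = pi / 4 - leibniz_sum (Suc (K + p))"
    ultimately have "S_term m n (Suc k) = 4 * (-1) ^ Suc (K + p) * T
        * (1 / 2 + - ((-1) ^ K)) / (2 * real K) ^ 2"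
      unfolding S_term_def kn Digamma_quarter_diff by simp
    also have "\<dots> = (-1) ^ p * (1 - (-1) ^ K / 2) * T / real K ^ 2"
      by (cases "even K"; cases "even p") (simp_all add: power_mult_distrib)
    finally show ?thesis by (simp add: K_def T_def)
  qed
  ultimately show ?thesis by simp
qed

text \<open>Splitting \<open>pi / 4 - leibniz_sum\<close> separates the double sum from a multiple
  of \<open>pi\<close>; the sign in \<open>n\<close> arises because \<open>p\<close> and
  \<open>n + 1\<close> have equal parity.\<close>

lemma initial_sum_eq:
  assumes "n + 1 = 2 * m + p"
  shows "- (\<Sum>k = 1..2 * m - 1. (-1) ^ p * (1 - (-1) ^ k / 2) * (pi / 4 - leibniz_sum (k + Suc p)) / real k ^ 2)
    = (\<Sum>k = 1..2 * m - 1. \<Sum>j = 0..k + p.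
             (-1) ^ (j + n) * (1 / 2 * (-1) ^ k - 1) / (real k ^ 2 * (2 * real j + 1)))
      - (\<Sum>k = 1..2 * m - 1. (-1) ^ n * (1 / 2 * (-1) ^ k - 1) / (4 * real k ^ 2)) * pi"
proof -
  have "(-1) ^ (n + 1) = ((-1) ^ p :: real)" unfolding assms by (simp add: power_add)
  then have np: "(-1) ^ p = (- ((-1) ^ n) :: real)" by simp
  have "(\<Sum>j = 0..k + p. (-1) ^ (j + n) * (1 / 2 * (-1) ^ k - 1) / (real k ^ 2 * (2 * real j + 1)))
      = (-1) ^ n * (1 / 2 * (-1) ^ k - 1) / real k ^ 2 * leibniz_sum (k + Suc p)" for k
    unfolding leibniz_sum_def sum_distrib_left
    by (intro sum.cong) (auto simp: power_add)
  then show ?thesis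
    unfolding np sum_distrib_right sum_negf[symmetric]
    by (simp add: sum_subtractf[symmetric]) (intro sum.cong refl; simp add: field_simps)
qed

text \<open>Summability is asserted separately because \<open>suminf\<close> is total. The
  subtraction in \<open>n + 1 - 2 * m\<close> is exact under the hypotheses, and the strict bounds
  in the last case count \<open>(n - 2 m + 1) / 2\<close> terms, none for
  \<open>n = 2 m - 1\<close>. Cases (i) and (ii) come from the closed forms at
  \<open>N = 0\<close>.\<close>

theorem theorem12:
  fixes m n :: nat
  assumes "m \<ge> 1" and "n \<ge> 1" and "n \<ge> 2 * m - 1"
  shows "summable (\<lambda>k. S_term m n (Suc k)) \<and>
    (n = 2 * m - 1 \<longrightarrow>
      S m n = 2
        - (\<Sum>k = 1..2 * m - 1. \<Sum>j = 0..k.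
             (-1) ^ j * (1 / 2 * (-1) ^ k - 1) / (real k ^ 2 * (2 * real j + 1)))
        + (- 1 + (\<Sum>k = 1..2 * m - 1. (1 / 2 * (-1) ^ k - 1) / (4 * real k ^ 2))) * pi
        + pi ^ 2 / 6 - pi ^ 3 / 96) \<and>
    (n = 2 * m \<longrightarrow>
      S m n = - (70 / 27)
        + (\<Sum>k = 1..2 * m - 1. \<Sum>j = 0..k + 1.
             (-1) ^ j * (1 / 2 * (-1) ^ k - 1) / (real k ^ 2 * (2 * real j + 1)))
        + (10 / 9 - (\<Sum>k = 1..2 * m - 1. (1 / 2 * (-1) ^ k - 1) / (4 * real k ^ 2))) * pi
        - pi ^ 2 / 9 + pi ^ 3 / 96) \<and>
    (odd (n + 1 - 2 * m) \<and> n + 1 - 2 * m \<noteq> 1 \<longrightarrow>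
      S m n = - (70 / 27)
        + 8 * (\<Sum>j = 1..(n - 2 * m) div 2.
             (2 * real j + 1) * (2 * harm (4 * j + 1) - harm (2 * j))
               / ((4 * real j + 3) ^ 2 * (4 * real j + 1) ^ 2))
        + 2 * (\<Sum>j = 1..(n - 2 * m) div 2. 1 / (4 * real j + 3) ^ 3)
        + (\<Sum>k = 1..2 * m - 1. \<Sum>j = 0..k + (n + 1 - 2 * m).
             (-1) ^ (j + n) * (1 / 2 * (-1) ^ k - 1) / (real k ^ 2 * (2 * real j + 1)))
        - 8 * (\<Sum>k = 1..(n - 2 * m) div 2. \<Sum>j = 0..2 * k.
             (-1) ^ j * (16 * real k ^ 2 + 16 * real k + 5)
               / ((2 * real j + 1) * (4 * real k + 3) ^ 2 * (4 * real k + 1) ^ 2))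
        + (10 / 9
            + (\<Sum>j = 1..(n - 2 * m) div 2.
                 2 * (16 * real j ^ 2 + 16 * real j + 5)
                   / ((4 * real j + 3) ^ 2 * (4 * real j + 1) ^ 2))
            - (\<Sum>k = 1..2 * m - 1. (-1) ^ n * (1 / 2 * (-1) ^ k - 1) / (4 * real k ^ 2))) * pi
        - (1 / 9 + 1 / 3 * (\<Sum>j = 1..(n - 2 * m) div 2.
                              1 / ((4 * real j + 3) * (4 * real j + 1)))) * pi ^ 2
        + pi ^ 3 / 96) \<and>
    (even (n + 1 - 2 * m) \<longrightarrow>
      S m n = 2
        + 16 * (\<Sum>j < (n + 1 - 2 * m) div 2.
             (real j + 1) * (2 * harm (4 * j + 3) - harm (2 * j + 1))
               / ((4 * real j + 5) ^ 2 * (4 * real j + 3) ^ 2))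
        + 2 * (\<Sum>j < (n + 1 - 2 * m) div 2. 1 / (4 * real j + 5) ^ 3)
        + (\<Sum>k = 1..2 * m - 1. \<Sum>j = 0..k + (n + 1 - 2 * m).
             (-1) ^ (j + n) * (1 / 2 * (-1) ^ k - 1) / (real k ^ 2 * (2 * real j + 1)))
        + 8 * (\<Sum>k < (n + 1 - 2 * m) div 2. \<Sum>j = 0..2 * k + 1.
             (-1) ^ j * (16 * real k ^ 2 + 32 * real k + 17)
               / ((2 * real j + 1) * (4 * real k + 5) ^ 2 * (4 * real k + 3) ^ 2))
        + (- 1
            - (\<Sum>j < (n + 1 - 2 * m) div 2.
                 2 * (16 * real j ^ 2 + 32 * real j + 17)
                   / ((4 * real j + 5) ^ 2 * (4 * real j + 3) ^ 2))
            - (\<Sum>k = 1..2 * m - 1. (-1) ^ n * (1 / 2 * (-1) ^ k - 1) / (4 * real k ^ 2))) * pi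
        + (1 / 2 - (\<Sum>j < (n + 1 - 2 * m) div 2.
                      1 / ((4 * real j + 5) * (4 * real j + 3)))) * (pi ^ 2 / 3)
        - pi ^ 3 / 96)"
proof -
  define p where "p = n + 1 - 2 * m"
  have np: "n + 1 = 2 * m + p" using assms by (simp add: p_def)
  note sums = S_sums[OF assms(1) np]
  have S: "S m n = tail_val (Suc p)
      + ((\<Sum>k = 1..2 * m - 1. \<Sum>j = 0..k + p.
             (-1) ^ (j + n) * (1 / 2 * (-1) ^ k - 1) / (real k ^ 2 * (2 * real j + 1)))
      - (\<Sum>k = 1..2 * m - 1. (-1) ^ n * (1 / 2 * (-1) ^ k - 1) / (4 * real k ^ 2)) * pi)"
    unfolding S_def using sums_unique[OF sums] initial_sum_eq[OF np] by simp
  show ?thesis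
  proof (intro conjI impI, goal_cases)
    case 1
    show ?case using sums by (rule sums_summable)
  next
    case 2
    \<comment> \<open>Odd \<open>n\<close> makes \<open>(-1) ^ n = -1\<close>, which explains the
      signs opposite to those in the other cases.\<close>
    then have "p = 0" "odd n" using assms by (auto simp: p_def)
    then have "(\<Sum>k = 1..2 * m - 1. \<Sum>j = 0..k + p.
             (-1) ^ (j + n) * (1 / 2 * (-1) ^ k - 1) / (real k ^ 2 * (2 * real j + 1)))
        = - (\<Sum>k = 1..2 * m - 1. \<Sum>j = 0..k.
             (-1) ^ j * (1 / 2 * (-1) ^ k - 1) / (real k ^ 2 * (2 * real j + 1)))"
      and "(\<Sum>k = 1..2 * m - 1. (-1) ^ n * (1 / 2 * (-1) ^ k - 1) / (4 * real k ^ 2))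
        = - (\<Sum>k = 1..2 * m - 1. (1 / 2 * (-1) ^ k - 1) / (4 * real k ^ 2))"
      unfolding sum_negf[symmetric] by (auto simp: power_add diff_divide_distrib intro!: sum.cong)
    moreover have "tail_val (Suc p) = 2 - pi + pi ^ 2 / 6 - pi ^ 3 / 96"
      using \<open>p = 0\<close> tail_val_odd[of 0] by simp
    ultimately show ?case unfolding S by (simp only:) (simp add: left_diff_distrib distrib_right)
  next
    case 3
    then have "p = 1" "even n" by (auto simp: p_def)
    then show ?case using S tail_val_even[of 0] by (simp add: power_add algebra_simps)
  next
    case 4
    then have "odd p" by (simp add: p_def)
    moreover have "n - 2 * m = p - 1" using np by simp
    ultimately have p: "Suc p = 2 * ((n - 2 * m) div 2) + 2" by (elim oddE) simp
    show ?case
      unfolding S p tail_val_even p_def[symmetric]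
      by (simp only: distrib_right left_diff_distrib)
  next
    case 5
    then have "even p" by (simp add: p_def)
    then have p: "Suc p = 2 * (p div 2) + 1" by simp
    show ?case
      unfolding S p tail_val_odd p_def[symmetric]
      by (simp only: distrib_right left_diff_distrib)
  qed
qed

end
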